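(* Let $q=2^d$ for some positive integer $d$, let $E=(\mathrm{GF}(q)^2,+)\cong C_2^{2d}$, let $K=C_{q+2}$ (written additively), and let $G=E\times K$. Let $\phi$ be the order $2$ automorphism of $G$ given by $((a,b),x)^\phi:=((b,a),-x)$. Let $e_1,\dots,e_{2d}$ be generators for $E$, let $u$ be the unique element of order $2$ of $K$, and let $K=\langle u,y\rangle$, so that $|y|=(q+2)/2$. Define the subgroup of $\langle\phi\rangle\ltimes G$ $$\mathcal{G}:=\langle(\phi,0,u),\ (1,0,y),\ (1,e_i,0) : 1\le i\le 2d\rangle.$$ Then $\mathcal{G}$ is a nonabelian group containing a difference set with McFarland parameters $$\left(q^2(q+2),\ q(q+1),\ q\right).$$
   Context: A subset $D$ of a finite group $G$ is a $(v,k,\lambda)$-difference set if $|G|=v$, $|D|=k$, and every nonidentity $g\in G$ can be expressed in exactly $\lambda$ ways as $d_1d_2^{-1}$ with $d_1,d_2\in D$. McFarland parameters, for a prime power $q$ and positive integer $s$, are $v=q^{s+1}\left(\frac{q^{s+1}-1}{q-1}+1\right)$, $k=q^s\,\frac{q^{s+1}-1}{q-1}$, $\lambda=q^s\,\frac{q^s-1}{q-1}$; here $s=1$. Elements of $\langle\phi\rangle\ltimes G$ are written as triples $(\alpha,b,c)$ with $\alpha\in\langle\phi\rangle$, $b\in E$, $c\in K$, where $(\alpha,b,c)$ stands for the pair $(\alpha,(b,c))$. Automorphisms act on the right and multiplication of pairs is $(\alpha,g)(\beta,h)=(\alpha\beta,\ g^\beta+h)$ for $\alpha,\beta\in\langle\phi\rangle$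 and $g,h\in G$. $0$ denotes the identity of $E$ and of $K$. *)

theory Defs
  imports
    "HOL-Algebra.Bij"
    "HOL-Algebra.Elementary_Groups"
    "HOL-Algebra.Multiplicative_Group"
    "HOL-Library.Cardinality"
    "HOL-Library.Product_Plus"
begin

definition difference_set ::
  "('g, 'm) monoid_scheme \<Rightarrow> nat \<times> nat \<times> nat \<Rightarrow> 'g set \<Rightarrow> bool" where
  "difference_set G = (\<lambda>(v, k, l) D.
     group G \<and> finite (carrier G) \<and> D \<subseteq> carrier G \<and>
     card (carrier G) = v \<and> card D = k \<and>
     (\<forall>g \<in> carrier G - {\<one>\<^bsub>G\<^esub>}.
        card {(d1, d2). d1 \<in> D \<and> d2 \<in> D \<and> d1 \<otimes>\<^bsub>G\<^esub> inv\<^bsub>G\<^esub> d2 = g} = l))"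

text \<open>All quotients below are exact for \<open>q \<ge> 2\<close>.\<close>

definition mcfarland_parameters :: "nat \<Rightarrow> nat \<Rightarrow> nat \<times> nat \<times> nat" where
  "mcfarland_parameters q s =
     (q ^ (s + 1) * ((q ^ (s + 1) - 1) div (q - 1) + 1),
      q ^ s * ((q ^ (s + 1) - 1) div (q - 1)),
      q ^ s * ((q ^ s - 1) div (q - 1)))"

text \<open>
  The semidirect product of a group \<open>A\<close> of automorphisms of \<open>G\<close> with \<open>G\<close>. Automorphisms act
  on the right, so the product \<open>\<alpha>\<beta>\<close> (first \<open>\<alpha>\<close>, then \<open>\<beta>\<close>) is \<open>\<beta> \<otimes> \<alpha>\<close> in \<^const>\<open>AutoGroup\<close>,
  whose multiplication is the composition of functions, and \<open>g\<^sup>\<beta>\<close> is \<open>\<beta> g\<close>.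
\<close>

definition semidirect ::
  "('g \<Rightarrow> 'g) set \<Rightarrow> ('g, 'm) monoid_scheme \<Rightarrow> (('g \<Rightarrow> 'g) \<times> 'g) monoid" where
  "semidirect A G =
     \<lparr>carrier = A \<times> carrier G,
      mult = (\<lambda>(\<alpha>, g) (\<beta>, h). (\<beta> \<otimes>\<^bsub>AutoGroup G\<^esub> \<alpha>, \<beta> g \<otimes>\<^bsub>G\<^esub> h)),
      one = (\<one>\<^bsub>AutoGroup G\<^esub>, \<one>\<^bsub>G\<^esub>)\<rparr>"

lemma (in group) group_semidirect:
  assumes A: "subgroup A (AutoGroup G)"
  shows "group (semidirect A G)"
proof -
  interpret Au: group "AutoGroup G" by (rule AutoGroup)
  have sub: "\<alpha> \<in> auto G" if "\<alpha> \<in> A" for \<alpha>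
    using subgroup.subset[OF A] that by (auto simp: AutoGroup_def)
  have cl: "\<alpha> x \<in> carrier G" if "\<alpha> \<in> A" "x \<in> carrier G" for \<alpha> x
    using sub[OF that(1)] that(2) by (auto simp: auto_def hom_def)
  have hm: "\<alpha> (x \<otimes> y) = \<alpha> x \<otimes> \<alpha> y"
    if "\<alpha> \<in> A" "x \<in> carrier G" "y \<in> carrier G" for \<alpha> x y
    using sub[OF that(1)] that by (auto simp: auto_def hom_def)
  have mu: "(\<alpha> \<otimes>\<^bsub>AutoGroup G\<^esub> \<beta>) x = \<alpha> (\<beta> x)"
    if "\<alpha> \<in> A" "\<beta> \<in> A" "x \<in> carrier G" for \<alpha> \<beta> x
    using sub[OF that(1)] sub[OF that(2)] that
    by (simp add: AutoGroup_def BijGroup_def auto_def compose_def)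
  have on: "\<one>\<^bsub>AutoGroup G\<^esub> x = x" if "x \<in> carrier G" for x
    using that by (simp add: AutoGroup_def BijGroup_def)
  have cA: "\<alpha> \<in> carrier (AutoGroup G)" if "\<alpha> \<in> A" for \<alpha>
    using subgroup.subset[OF A] that by auto
  have h1: "\<alpha> \<one> = \<one>" if "\<alpha> \<in> A" for \<alpha>
    using hm[OF that one_closed one_closed] cl[OF that one_closed] by (metis one_closed r_cancel_one' r_one)
  note ms = subgroup.m_closed[OF A] subgroup.one_closed[OF A] subgroup.m_inv_closed[OF A]
  show ?thesis
  proof (rule groupI)
    fix x assume "x \<in> carrier (semidirect A G)"
    then obtain \<alpha> g where x: "x = (\<alpha>, g)" "\<alpha> \<in> A" "g \<in> carrier G"
      by (auto simp: semidirect_def)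
    let ?\<beta> = "inv\<^bsub>AutoGroup G\<^esub> \<alpha>"
    have b: "?\<beta> \<in> A" using x ms by auto
    have "\<alpha> (?\<beta> (inv g)) = inv g"
      using mu[OF x(2) b, of "inv g"] on x cA by simp
    then have "(?\<beta>, ?\<beta> (inv g)) \<otimes>\<^bsub>semidirect A G\<^esub> x = \<one>\<^bsub>semidirect A G\<^esub>"
      using x cA by (simp add: semidirect_def)
    then show "\<exists>y \<in> carrier (semidirect A G). y \<otimes>\<^bsub>semidirect A G\<^esub> x = \<one>\<^bsub>semidirect A G\<^esub>"
      using x b cl by (intro bexI[of _ "(?\<beta>, ?\<beta> (inv g))"]) (auto simp: semidirect_def)
  qed (auto simp: semidirect_def ms cl hm h1 mu on cA m_assoc Au.m_assoc)
qed

text \<open>\<open>E\<close> is the additive group of \<open>GF(q)\<^sup>2\<close>; \<open>K\<close> is the additive group of integers modulo \<open>q + 2\<close>.\<close>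

definition grp_E :: "('a::field \<times> 'a) monoid" where
  "grp_E = \<lparr>carrier = UNIV, mult = (+), one = 0\<rparr>"

abbreviation grp_K :: "nat \<Rightarrow> int monoid" where
  "grp_K q \<equiv> integer_mod_group (q + 2)"

abbreviation grp_G :: "nat \<Rightarrow> (('a::field \<times> 'a) \<times> int) monoid" where
  "grp_G q \<equiv> grp_E \<times>\<times> grp_K q"

definition phi :: "nat \<Rightarrow> ('a::field \<times> 'a) \<times> int \<Rightarrow> ('a \<times> 'a) \<times> int" where
  "phi q = (\<lambda>((a, b), x) \<in> carrier (grp_G q). ((b, a), inv\<^bsub>grp_K q\<^esub> x))"

definition phi_G :: "nat \<Rightarrow>
    ((('a::field \<times> 'a) \<times> int \<Rightarrow> ('a \<times> 'a) \<times> int) \<times> ('a \<times> 'a) \<times> int) monoid" where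
  "phi_G q = semidirect (generate (AutoGroup (grp_G q)) {phi q}) (grp_G q)"

text \<open>
  The triple \<open>(\<alpha>, b, c)\<close> is literally the pair \<open>(\<alpha>, (b, c))\<close>. The identity automorphism is
  the identity function restricted to the carrier, as automorphisms are extensional functions.
\<close>

definition calG :: "nat \<Rightarrow> ('a::field \<times> 'a) set \<Rightarrow> int \<Rightarrow> int \<Rightarrow>
    ((('a \<times> 'a) \<times> int \<Rightarrow> ('a \<times> 'a) \<times> int) \<times> ('a \<times> 'a) \<times> int) monoid" where
  "calG q B u y = subgroup_generated (phi_G q)
     ({(phi q, 0, u), (\<one>\<^bsub>AutoGroup (grp_G q)\<^esub>, 0, y)} \<union>
      {(\<one>\<^bsub>AutoGroup (grp_G q)\<^esub>, b, 0) | b. b \<in> B})"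

lemma group_grp_E: "group (grp_E :: ('a::field \<times> 'a) monoid)"
proof (rule groupI)
  fix x :: "'a \<times> 'a"
  show "\<exists>y \<in> carrier grp_E. y \<otimes>\<^bsub>grp_E\<^esub> x = \<one>\<^bsub>grp_E\<^esub>"
    by (rule bexI[of _ "- x"]) (auto simp: grp_E_def)
qed (auto simp: grp_E_def add.assoc)

lemma group_grp_G: "group (grp_G q :: (('a::field \<times> 'a) \<times> int) monoid)"
  by (intro DirProd_group group_grp_E group_integer_mod_group)

lemma phi_apply:
  assumes "x \<in> carrier (grp_K q)"
  shows "phi q ((a, b), x) = ((b, a), (- x) mod (int q + 2))"
  using assms by (simp add: phi_def grp_E_def add.commute)

lemma dvd_two_cases: "n = 2" if "n dvd 2" "\<not> n dvd 1" for n :: nat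
proof -
  have "n \<le> 2" using that(1) by (rule dvd_imp_le) simp
  with that show ?thesis by (cases "n = 0"; cases "n = 1") auto
qed

lemma mod_minus_minus: "(- ((- x) mod m)) mod m = x" if "0 \<le> x" "x < m" for x m :: int
  using that by (simp add: mod_minus_eq)

lemma phi_in_auto: "phi q \<in> auto (grp_G q)"
proof -
  have K: "carrier (grp_K q) = {0..<int q + 2}"
    by (simp add: carrier_integer_mod_group add.commute)
  have cl: "phi q p \<in> carrier (grp_G q)" if "p \<in> carrier (grp_G q)" for p :: "('a \<times> 'a) \<times> int"
    using that by (cases p) (auto simp: phi_apply K grp_E_def simp del: add_2_eq_Suc')
  have inv: "phi q (phi q p) = p" if "p \<in> carrier (grp_G q)" for p :: "('a \<times> 'a) \<times> int"
    using that
    by (cases p) (auto simp: phi_apply K mod_minus_minus grp_E_def simp del: add_2_eq_Suc')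
  have "bij_betw (phi q) (carrier (grp_G q)) (carrier (grp_G q) :: (('a \<times> 'a) \<times> int) set)"
    by (rule bij_betw_byWitness[where f' = "phi q"]) (use cl inv in blast)+
  moreover have "phi q \<in> hom (grp_G q) (grp_G q :: (('a \<times> 'a) \<times> int) monoid)"
  proof (rule homI)
    fix p r :: "('a \<times> 'a) \<times> int"
    assume p: "p \<in> carrier (grp_G q)" and r: "r \<in> carrier (grp_G q)"
    obtain a b x c d z where pr: "p = ((a, b), x)" "r = ((c, d), z)"
      by (metis surj_pair)
    have m: "p \<otimes>\<^bsub>grp_G q\<^esub> r = ((a + c, b + d), (x + z) mod (int q + 2))"
      by (simp add: pr grp_E_def add.commute)
    have "(- ((x + z) mod (int q + 2))) mod (int q + 2)
        = ((- x) mod (int q + 2) + (- z) mod (int q + 2)) mod (int q + 2)"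
      by (simp add: mod_minus_eq mod_add_eq)
    then show "phi q (p \<otimes>\<^bsub>grp_G q\<^esub> r) = phi q p \<otimes>\<^bsub>grp_G q\<^esub> phi q r"
      unfolding m using p r by (simp add: pr phi_apply K grp_E_def add.commute del: add_2_eq_Suc')
  qed (use cl in auto)
  moreover have "phi q \<in> extensional (carrier (grp_G q) :: (('a \<times> 'a) \<times> int) set)"
    unfolding phi_def by (rule restrict_extensional)
  ultimately show ?thesis
    by (auto simp: auto_def Bij_def)
qed

lemma group_phi_G: "group (phi_G q :: ((('a::field \<times> 'a) \<times> int \<Rightarrow> _) \<times> _) monoid)"
proof -
  interpret G: group "grp_G q :: (('a \<times> 'a) \<times> int) monoid" by (rule group_grp_G)
  interpret Au: group "AutoGroup (grp_G q :: (('a \<times> 'a) \<times> int) monoid)" by (rule G.AutoGroup)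
  have "{phi q} \<subseteq> carrier (AutoGroup (grp_G q :: (('a \<times> 'a) \<times> int) monoid))"
    using phi_in_auto by (auto simp: AutoGroup_def)
  then show ?thesis
    unfolding phi_G_def by (intro G.group_semidirect Au.generate_is_subgroup)
qed

lemma phi_ord: "group.ord (AutoGroup (grp_G q :: (('a::field \<times> 'a) \<times> int) monoid)) (phi q) = 2"
proof -
  interpret G: group "grp_G q :: (('a \<times> 'a) \<times> int) monoid" by (rule group_grp_G)
  interpret Au: group "AutoGroup (grp_G q :: (('a \<times> 'a) \<times> int) monoid)" by (rule G.AutoGroup)
  let ?A = "AutoGroup (grp_G q :: (('a \<times> 'a) \<times> int) monoid)"
  have K: "carrier (grp_K q) = {0..<int q + 2}"
    by (simp add: carrier_integer_mod_group add.commute)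
  have c: "phi q \<in> carrier ?A"
    using phi_in_auto by (auto simp: AutoGroup_def)
  have "(phi q \<otimes>\<^bsub>?A\<^esub> phi q) p = \<one>\<^bsub>?A\<^esub> p" for p
  proof (cases "p \<in> carrier (grp_G q)")
    case True
    then show ?thesis
      using phi_in_auto[of q, where 'a = 'a] by (cases p)
        (auto simp: AutoGroup_def BijGroup_def auto_def compose_def phi_apply K grp_E_def
          mod_minus_minus simp del: add_2_eq_Suc')
  next
    case False
    then show ?thesis
      using phi_in_auto[of q, where 'a = 'a]
      by (auto simp: AutoGroup_def BijGroup_def auto_def compose_def)
  qed
  then have "phi q [^]\<^bsub>?A\<^esub> (2::nat) = \<one>\<^bsub>?A\<^esub>"
    using c by (metis Au.nat_pow_Suc Au.nat_pow_0 Au.l_one ext numeral_2_eq_2)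
  then have "Au.ord (phi q) dvd 2"
    using Au.pow_eq_id[OF c] by blast
  moreover have "phi q \<noteq> \<one>\<^bsub>?A\<^esub>"
  proof
    assume "phi q = \<one>\<^bsub>?A\<^esub>"
    then have "phi q ((0 :: 'a, 1 :: 'a), 0 :: int) = \<one>\<^bsub>?A\<^esub> ((0, 1), 0)" by simp
    then show False
      by (simp add: phi_apply AutoGroup_def BijGroup_def grp_E_def)
  qed
  then have "\<not> Au.ord (phi q) dvd 1"
    using Au.pow_eq_id[OF c, of 1] Au.nat_pow_eone[OF c] by simp
  ultimately show ?thesis
    by (rule dvd_two_cases)
qed

text \<open>For even \<open>q\<close> the group \<open>K\<close> has exactly one element of order 2.\<close>

lemma grp_K_ord_two_iff:
  assumes "even q" and u: "u \<in> carrier (grp_K q)"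
  shows "group.ord (grp_K q) u = 2 \<longleftrightarrow> u = (int q + 2) div 2"
proof -
  interpret K: group "grp_K q" by simp
  obtain m where m: "q = 2 * m" using assms by auto
  have r: "0 \<le> u" "u < 2 * int m + 2"
    using u by (auto simp: carrier_integer_mod_group m)
  have 2: "K.ord u dvd n \<longleftrightarrow> (2 * int m + 2) dvd int n * u" for n
    using K.pow_eq_id[OF u, of n]
    by (simp add: m dvd_eq_mod_eq_0 add.commute del: add_2_eq_Suc add_2_eq_Suc')
  show ?thesis
  proof
    assume o: "K.ord u = 2"
    have "\<not> (2 * int m + 2) dvd u" "(2 * int m + 2) dvd 2 * u"
      using 2[of 1] 2[of 2] o by auto
    then obtain k where k: "2 * u = (2 * int m + 2) * k" "u \<noteq> 0" by auto
    have "0 < k" using k r by (smt (verit) mult_nonneg_nonpos)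
    moreover have "k < 2"
    proof (rule ccontr)
      assume "\<not> k < 2"
      then have "(2 * int m + 2) * 2 \<le> (2 * int m + 2) * k" by (intro mult_left_mono) auto
      then have "(2 * int m + 2) * 2 \<le> 2 * u" by (simp only: k(1))
      then show False using r(2) by (simp add: algebra_simps)
    qed
    ultimately have "k = 1" by linarith
    with k show "u = (int q + 2) div 2" by (simp add: m)
  next
    assume "u = (int q + 2) div 2"
    then have u': "u = int m + 1" by (simp add: m)
    have "K.ord u dvd 2" using 2[of 2] by (simp add: u')
    moreover have "\<not> K.ord u dvd 1"
    proof
      assume "K.ord u dvd 1"
      then have "(2 * int m + 2) dvd int m + 1" using 2[of 1] by (simp add: u')
      then show False using zdvd_imp_le[of "2 * int m + 2" "int m + 1"] by simp
    qed
    ultimately show "K.ord u = 2"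
      by (rule dvd_two_cases)
  qed
qed

text \<open>
  For \<open>q = 2 ^ d\<close> with \<open>d \<ge> 2\<close>, an element \<open>y\<close> of order \<open>(q + 2) / 2\<close> satisfies
  \<open>K = \<langle>u, y\<rangle>\<close>, so requiring the order alone loses nothing. For \<open>q = 2\<close> the two conditions
  on \<open>y\<close> contradict each other; requiring the order alone means \<open>y = u\<close> and gives a group of
  the right size \<open>q\<^sup>2 (q + 2) = 16\<close>, whereas \<open>K = \<langle>u, y\<rangle>\<close> would give one of size 32.
\<close>

lemma generate_grp_K:
  assumes q: "q = 2 ^ d" "d \<ge> 2"
    and u: "u \<in> carrier (grp_K q)" "group.ord (grp_K q) u = 2"
    and y: "y \<in> carrier (grp_K q)" "group.ord (grp_K q) y = (q + 2) div 2"
  shows "generate (grp_K q) {u, y} = carrier (grp_K q)"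
proof -
  let ?K = "grp_K q" let ?H = "generate ?K {u, y}"
  interpret K: group ?K by simp
  have fin: "finite (carrier ?K)" and crd: "card (carrier ?K) = q + 2"
    by (simp_all add: carrier_integer_mod_group)
  have H: "subgroup ?H ?K" using u y by (intro K.generate_is_subgroup) auto
  interpret H: group "?K\<lparr>carrier := ?H\<rparr>" by (rule K.subgroup_imp_group[OF H])
  have finH: "finite ?H" using fin H by (meson finite_subset subgroup.subset)
  have "K.ord x dvd card ?H" if "x \<in> {u, y}" for x
  proof -
    have x: "x \<in> carrier ?K" using that u y by auto
    have "subgroup (generate ?K {x}) (?K\<lparr>carrier := ?H\<rparr>)"
      using x that u y H by (intro K.subgroup_incl K.generate_is_subgroup K.mono_generate) auto
    from H.lagrange[OF this] have "card (generate ?K {x}) dvd card ?H"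
      unfolding order_def by (simp del: add_2_eq_Suc') (metis dvd_triv_right)
    then show ?thesis using K.generate_pow_card[OF x] by simp
  qed
  then have dv: "2 dvd card ?H" "(q + 2) div 2 dvd card ?H"
    using u y by (metis insertI1, metis insertI1 insert_commute)
  obtain c where "d = Suc (Suc c)" using q(2) by (metis add_2_eq_Suc le_Suc_ex)
  then have half: "(q + 2) div 2 = 2 * 2 ^ c + 1" "q + 2 = 2 * ((q + 2) div 2)"
    using q by auto
  then have "coprime 2 ((q + 2) div 2)" by simp
  with dv have "q + 2 dvd card ?H"
    using half(2) divides_mult by metis
  moreover have "0 < card ?H" using finH H by (metis card_gt_0_iff subgroup.one_closed empty_iff)
  ultimately have "card (carrier ?K) \<le> card ?H" using crd by (simp add: dvd_imp_le)
  then show ?thesis using card_seteq[OF fin subgroup.subset[OF H]] by simp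
qed

end

theory Submission
  imports Defs
begin

text \<open>
  The proof is McFarland's construction in the twisted form due to Dillon. The subgroup
  \<open>E = GF(q)\<^sup>2\<close> is normal in the group \<open>\<G>\<close> with \<open>q + 2\<close> cosets, and it has \<open>q + 1\<close> lines
  \<open>L\<^sub>p\<close>, subgroups of order \<open>q\<close> that partition the nonzero vectors. Put each line into a coset of its own:
  \<open>D\<close> is the union of the sets \<open>g\<^sub>p L\<^sub>p\<close>. In the list of quotients \<open>d\<^sub>1 d\<^sub>2\<^sup>-\<^sup>1\<close>, two different
  lines contribute the full coset \<open>g\<^sub>p E g\<^sub>r\<^sup>-\<^sup>1\<close> once each, since
  \<open>L\<^sub>p + L\<^sub>r = E\<close>, and all the cosets other than \<open>E\<close> are obtained equally often, \<open>q\<close> times, because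
  only one coset is left out. A single line contributes \<open>q\<close> copies of its conjugate
  \<open>g\<^sub>p L\<^sub>p g\<^sub>p\<^sup>-\<^sup>1\<close>. Hence \<open>D\<close> is a difference set with \<open>\<lambda> = q\<close> as soon as these conjugates partition
  the nonzero vectors again. This is
  \<open>difference_set_of_twisted_partitions\<close>, valid in any finite group.

  The group \<open>\<G>\<close> is the set of all \<open>(1, b, c)\<close> and \<open>(\<phi>, b, u + c)\<close> with \<open>c \<in> \<langle>y\<rangle>\<close>
  (\<open>carrier_calG\<close>), so it has \<open>(q + 2) / 2\<close> cosets of \<open>E\<close> of either kind. Elements
  of the first kind commute with \<open>E\<close>; those of the second kind act on it by exchanging the coordinates,
  which is also why \<open>\<G>\<close> is not abelian. The conjugates are all the lines again if the set \<open>S\<close> of the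
  lines that are put into cosets of the second kind is invariant under the exchange. The exchange is an
  involution on the lines that fixes the diagonal, so it has invariant sets of every size
  (\<open>involution_invariant_subset\<close>), in particular one with \<open>(q + 2) / 2\<close> lines; the other \<open>q / 2\<close>
  lines go into cosets of the first kind.
\<close>

section \<open>Difference sets from partitions of a normal subgroup\<close>

text \<open>
  In the list of quotients, this counts how often a nontrivial coset of \<open>E\<close> arises: in the quotient
  group, the translate of the complement of a point omits one other point.
\<close>

lemma (in group) card_translate_complement_point:
  assumes fin: "finite (carrier G)" and U: "U \<subseteq> carrier G" "Suc (card U) = order G"
    and x: "x \<in> carrier G" "x \<noteq> \<one>"
  shows "card {c \<in> U. x \<otimes> c \<in> U} = order G - 2"
proof -
  have "card (carrier G - U) = 1"
    using card_Diff_subset[OF finite_subset[OF U(1) fin] U(1)] U(2) by (simp add: order_def)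
  then obtain w where w: "carrier G - U = {w}" by (auto simp: card_1_singleton_iff)
  then have wc: "w \<in> carrier G" and iff: "c \<in> U \<longleftrightarrow> c \<in> carrier G \<and> c \<noteq> w" for c
    using U(1) by blast+
  have "x \<otimes> c = w \<longleftrightarrow> c = inv x \<otimes> w" if "c \<in> carrier G" for c
    using that wc x inv_solve_left[of c x w] by auto
  then have "{c \<in> U. x \<otimes> c \<in> U} = carrier G - {w, inv x \<otimes> w}"
    using x by (auto simp: iff)
  moreover have "inv x \<otimes> w \<noteq> w"
    using x wc by simp
  ultimately show ?thesis
    using wc x fin by (simp add: card_Diff_subset order_def)
qed

text \<open>
  The map \<open>(a, b) \<mapsto> a b\<^sup>-\<^sup>1\<close> from \<open>A \<times> B\<close> to \<open>E\<close> is injective because \<open>A\<close> and \<open>B\<close> meet trivially,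
  hence bijective by counting; the \<open>h\<close> sought is the \<open>B\<close>-component of the preimage of \<open>e\<close>.
\<close>

lemma (in group) complementary_subgroups_unique_solution:
  assumes E: "subgroup E G" "finite E"
    and A: "subgroup A G" "A \<subseteq> E" and B: "subgroup B G" "B \<subseteq> E"
    and AB: "A \<inter> B = {\<one>}" "card E = card A * card B"
    and e: "e \<in> E"
  shows "\<exists>!h. h \<in> B \<and> e \<otimes> h \<in> A"
proof -
  note sub = subgroup.subset[OF E(1)] subgroup.subset[OF A(1)] subgroup.subset[OF B(1)]
  let ?f = "\<lambda>(a, b). a \<otimes> inv b"
  have inj: "inj_on ?f (A \<times> B)"
  proof (rule inj_onI, clarify)
    fix a b a' b' assume ab: "a \<in> A" "b \<in> B" "a' \<in> A" "b' \<in> B"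
      and eq: "a \<otimes> inv b = a' \<otimes> inv b'"
    have c: "a \<in> carrier G" "b \<in> carrier G" "a' \<in> carrier G" "b' \<in> carrier G"
      using ab sub by auto
    have "inv a' \<otimes> a = inv b' \<otimes> b"
    proof -
      have "inv a' \<otimes> a = inv a' \<otimes> (a \<otimes> inv b) \<otimes> b" using c by (simp add: m_assoc)
      also have "\<dots> = inv b' \<otimes> b" unfolding eq using c by (simp flip: m_assoc)
      finally show ?thesis .
    qed
    moreover have "inv a' \<otimes> a \<in> A" "inv b' \<otimes> b \<in> B"
      using ab A(1) B(1) by (auto intro: subgroup.m_closed subgroup.m_inv_closed)
    ultimately have "inv a' \<otimes> a = \<one>" "inv b' \<otimes> b = \<one>" using AB(1) by auto
    then show "a = a' \<and> b = b'" using c by (metis inv_equality inv_inv inv_closed)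
  qed
  have "?f ` (A \<times> B) \<subseteq> E"
    using E(1) A(2) B(2) by (auto intro!: subgroup.m_closed subgroup.m_inv_closed)
  then have "?f ` (A \<times> B) = E"
    using card_image[OF inj] AB(2) E(2) by (intro card_subset_eq) (auto simp: card_cartesian_product)
  then obtain a b where ab: "a \<in> A" "b \<in> B" "e = a \<otimes> inv b" using e by auto
  have c: "a \<in> carrier G" "b \<in> carrier G" using ab sub by auto
  show ?thesis
  proof (rule ex1I[of _ b])
    show "b \<in> B \<and> e \<otimes> b \<in> A" using ab c by (simp add: m_assoc)
    fix h assume h: "h \<in> B \<and> e \<otimes> h \<in> A"
    then have "h \<in> carrier G" "e \<in> carrier G" using sub e by auto
    then have "?f (e \<otimes> h, h) = ?f (a, b)" using ab(3) by (simp add: m_assoc)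
    then show "h = b" using inj_onD[OF inj, of "(e \<otimes> h, h)" "(a, b)"] h ab by auto
  qed
qed

text \<open>
  The last hypothesis says that the conjugates \<open>g i H i (g i)\<^sup>-\<^sup>1\<close> partition the nonidentity elements of
  \<open>E\<close>; it is stated without inverses, which suits computations with cosets. The multiplicity of \<open>x\<close>
  among the quotients is the number of \<open>d \<in> D\<close> with \<open>x d \<in> D\<close>. For \<open>x \<in> E\<close>, multiplication by \<open>x\<close>
  preserves each coset, and it maps the piece \<open>g i H i\<close> to itself or to a set disjoint from it,
  according to whether \<open>x\<close> lies in the conjugate of \<open>H i\<close>. For \<open>x \<notin> E\<close>, it moves the
  piece with index \<open>i\<close> into the coset of another index \<open>j\<close> or into the unused coset; in the first
  case it meets the piece with index \<open>j\<close> in one point, as \<open>H i\<close> and \<open>H j\<close> are complementary in \<open>E\<close>.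
\<close>

theorem (in group) difference_set_of_twisted_partitions:
  assumes fin: "finite (carrier G)" and N: "E \<lhd> G"
    and cE: "card E = q\<^sup>2" and cG: "order G = q\<^sup>2 * (q + 2)"
    and I: "finite I" "card I = q + 1"
    and H: "\<And>i. i \<in> I \<Longrightarrow> subgroup (H i) G" "\<And>i. i \<in> I \<Longrightarrow> H i \<subseteq> E"
      "\<And>i. i \<in> I \<Longrightarrow> card (H i) = q"
    and disj: "\<And>i j. \<lbrakk>i \<in> I; j \<in> I; i \<noteq> j\<rbrakk> \<Longrightarrow> H i \<inter> H j = {\<one>}"
    and g: "\<And>i. i \<in> I \<Longrightarrow> g i \<in> carrier G" "inj_on (\<lambda>i. E #> g i) I"
    and conj: "\<And>x. \<lbrakk>x \<in> E; x \<noteq> \<one>\<rbrakk> \<Longrightarrow> \<exists>!i. i \<in> I \<and> x \<otimes> g i \<in> g i <# H i"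
  shows "difference_set G (q\<^sup>2 * (q + 2), q * (q + 1), q) (\<Union>i\<in>I. g i <# H i)"
proof -
  interpret N: normal E G by (rule N)
  interpret Q: group "G Mod E" by (rule N.factorgroup_is_group)
  define D where "D = (\<Union>i\<in>I. g i <# H i)"
  have D_iff: "d \<in> D \<longleftrightarrow> (\<exists>i\<in>I. d \<in> g i <# H i)" for d
    by (simp add: D_def)
  let ?p = "\<lambda>x. E #> x"
  have sE: "subgroup E G" by (rule N.subgroup_axioms)
  have Ec: "x \<in> carrier G" if "x \<in> E" for x using that by (rule N.mem_carrier)
  have finE: "finite E" using fin N.subset by (rule rev_finite_subset)
  have Hc: "h \<in> carrier G" if "i \<in> I" "h \<in> H i" for i h using H(2) Ec that by blast
  have finH: "finite (H i)" if "i \<in> I" for i using H(2)[OF that] finE by (rule finite_subset)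
  have q0: "q > 0" using cE finE sE
    by (metis card_gt_0_iff empty_iff subgroup.one_closed neq0_conv power_zero_numeral)
  have p_hom: "?p (x \<otimes> y) = ?p x \<otimes>\<^bsub>G Mod E\<^esub> ?p y" if "x \<in> carrier G" "y \<in> carrier G" for x y
    using N.r_coset_hom_Mod that by (auto simp: hom_def)
  have p_car: "?p x \<in> carrier (G Mod E)" if "x \<in> carrier G" for x
    using N.r_coset_hom_Mod that by (auto simp: hom_def)
  have p_one: "?p x = \<one>\<^bsub>G Mod E\<^esub> \<longleftrightarrow> x \<in> E" if "x \<in> carrier G" for x
    using that sE by (metis coset_join1 coset_join2 N.subset one_FactGroup)
  have p_E: "?p (x \<otimes> h) = ?p x" if "x \<in> carrier G" "h \<in> E" for x h
    using that p_hom[of x h] p_one[of h] Ec p_car Q.r_one by metis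
  have p_D: "?p d = ?p (g i)" "d \<in> carrier G" if "i \<in> I" "d \<in> g i <# H i" for i d
  proof -
    from that(2) obtain h where h: "h \<in> H i" "d = g i \<otimes> h" by (auto simp: l_coset_def)
    then have hE: "h \<in> E" using H(2)[OF that(1)] by blast
    show "?p d = ?p (g i)" unfolding h(2) by (rule p_E[OF g(1)[OF that(1)] hE])
    show "d \<in> carrier G" unfolding h(2) using g(1)[OF that(1)] Ec[OF hE] by simp
  qed
  have cardQ: "order (G Mod E) = q + 2"
  proof -
    have "order (G Mod E) * q\<^sup>2 = (q + 2) * q\<^sup>2"
      using lagrange[OF sE] cE cG by (simp add: order_def FactGroup_def mult.commute)
    then show ?thesis using q0 by (simp only: mult_cancel2) simp
  qed
  have finQ: "finite (carrier (G Mod E))"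
    using cardQ Q.order_gt_0_iff_finite by simp
  have inj_l: "inj_on (\<lambda>h. x \<otimes> h) (H i)" if "x \<in> carrier G" "i \<in> I" for x i
    using that Hc by (auto intro!: inj_onI)
  have cl: "card (g i <# H i) = q" "finite (g i <# H i)" if "i \<in> I" for i
  proof -
    have "g i <# H i = (\<lambda>h. g i \<otimes> h) ` H i" by (auto simp: l_coset_def)
    then show "card (g i <# H i) = q" "finite (g i <# H i)"
      using card_image[OF inj_l[OF g(1) that]] that H(3) finH by auto
  qed
  have ij: "i = j" if "i \<in> I" "j \<in> I" "d \<in> g i <# H i" "d' \<in> g j <# H j" "?p d = ?p d'" for i j d d'
    using inj_onD[OF g(2) _ that(1,2)] p_D(1)[OF that(1,3)] p_D(1)[OF that(2,4)] that(5) by simp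
  have card_part: "card {d \<in> D. P d} = (\<Sum>i\<in>I. card {d \<in> g i <# H i. P d})" for P
  proof -
    have "{d \<in> D. P d} = (\<Union>i\<in>I. {d \<in> g i <# H i. P d})" by (auto simp: D_iff)
    also have "card \<dots> = (\<Sum>i\<in>I. card {d \<in> g i <# H i. P d})"
    proof (rule card_UN_disjoint[OF I(1)])
      show "\<forall>i\<in>I. finite {d \<in> g i <# H i. P d}" using cl(2) by simp
      show "\<forall>i\<in>I. \<forall>j\<in>I. i \<noteq> j \<longrightarrow> {d \<in> g i <# H i. P d} \<inter> {d \<in> g j <# H j. P d} = {}"
        using ij by blast
    qed
    finally show ?thesis .
  qed
  have cardD: "card D = q * (q + 1)"
    using card_part[of "\<lambda>_. True"] cl(1) I by (simp add: algebra_simps)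
  have inE: "card {d \<in> D. x \<otimes> d \<in> D} = q" if x: "x \<in> E" "x \<noteq> \<one>" for x
  proof -
    obtain k where k: "k \<in> I" "x \<otimes> g k \<in> g k <# H k"
      and uniq: "\<And>i. i \<in> I \<Longrightarrow> x \<otimes> g i \<in> g i <# H i \<Longrightarrow> i = k"
      using conj[OF x] by blast
    have xc: "x \<in> carrier G" using x Ec by auto
    have px: "?p (x \<otimes> d) = ?p d" if "d \<in> carrier G" for d
      using p_hom[OF xc that] p_one[OF xc] x that p_car Q.l_one by metis
    have iff: "x \<otimes> d \<in> D \<longleftrightarrow> x \<otimes> g i \<in> g i <# H i" if i: "i \<in> I" and d: "d \<in> g i <# H i" for i d
    proof -
      obtain h where h: "h \<in> H i" "d = g i \<otimes> h" using d by (auto simp: l_coset_def)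
      note c = xc g(1)[OF i] Hc[OF i] h(1)
      have "x \<otimes> d \<in> D \<longleftrightarrow> x \<otimes> d \<in> g i <# H i"
      proof
        assume "x \<otimes> d \<in> D"
        then obtain j where j: "j \<in> I" "x \<otimes> d \<in> g j <# H j" by (auto simp: D_iff)
        have "i = j" using ij[OF i j(1) d j(2)] px[OF p_D(2)[OF i d]] by simp
        then show "x \<otimes> d \<in> g i <# H i" using j by simp
      qed (use i D_iff in blast)
      also have "\<dots> \<longleftrightarrow> x \<otimes> g i \<in> g i <# H i"
      proof
        assume "x \<otimes> d \<in> g i <# H i"
        then obtain h' where h': "h' \<in> H i" "x \<otimes> g i \<otimes> h = g i \<otimes> h'"
          using h c by (auto simp: l_coset_def m_assoc)
        have "x \<otimes> g i = x \<otimes> g i \<otimes> h \<otimes> inv h" using c by (simp add: m_assoc)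
        then have "x \<otimes> g i = g i \<otimes> (h' \<otimes> inv h)"
          unfolding h'(2) using c Hc[OF i h'(1)] by (simp add: m_assoc)
        then show "x \<otimes> g i \<in> g i <# H i"
          using h' h(1) H(1)[OF i]
          by (auto simp: l_coset_def intro!: subgroup.m_closed subgroup.m_inv_closed)
      next
        assume "x \<otimes> g i \<in> g i <# H i"
        then obtain h' where h': "h' \<in> H i" "x \<otimes> g i = g i \<otimes> h'" by (auto simp: l_coset_def)
        then have "x \<otimes> d = g i \<otimes> (h' \<otimes> h)"
          using h(2) c Hc[OF i h'(1)] by (simp flip: m_assoc)
        then show "x \<otimes> d \<in> g i <# H i"
          using h' h(1) H(1)[OF i] by (auto simp: l_coset_def intro!: subgroup.m_closed)
      qed
      finally show ?thesis .
    qed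
    have "card {d \<in> g i <# H i. x \<otimes> d \<in> D} = (if i = k then q else 0)" if i: "i \<in> I" for i
    proof (cases "i = k")
      case True
      then have "{d \<in> g i <# H i. x \<otimes> d \<in> D} = g i <# H i" using iff[OF i] k by blast
      then show ?thesis using cl(1)[OF i] True by simp
    next
      case False
      then have "{d \<in> g i <# H i. x \<otimes> d \<in> D} = {}" using iff[OF i] uniq i by blast
      then show ?thesis using False by (simp only: if_False card.empty)
    qed
    then show ?thesis using card_part[of "\<lambda>d. x \<otimes> d \<in> D"] k I by simp
  qed
  have notinE: "card {d \<in> D. x \<otimes> d \<in> D} = q" if x: "x \<in> carrier G" "x \<notin> E" for x
  proof -
    let ?U = "(\<lambda>i. ?p (g i)) ` I"
    let ?P = "\<lambda>i. ?p x \<otimes>\<^bsub>G Mod E\<^esub> ?p (g i) \<in> ?U"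
    have "card {d \<in> g i <# H i. x \<otimes> d \<in> D} = (if ?P i then 1 else 0)" if i: "i \<in> I" for i
    proof (cases "?P i")
      case False
      have "x \<otimes> d \<notin> D" if "d \<in> g i <# H i" for d
      proof
        assume "x \<otimes> d \<in> D"
        then obtain j where j: "j \<in> I" "x \<otimes> d \<in> g j <# H j" by (auto simp: D_iff)
        have "?p x \<otimes>\<^bsub>G Mod E\<^esub> ?p (g i) = ?p (g j)"
          using p_hom[OF x(1) p_D(2)[OF i that]] p_D(1)[OF i that] p_D(1)[OF j] by metis
        with False j(1) show False by blast
      qed
      then have "{d \<in> g i <# H i. x \<otimes> d \<in> D} = {}" by blast
      then show ?thesis using False by (simp only: if_False card.empty)
    next
      case True
      then obtain j where j: "j \<in> I" "?p (x \<otimes> g i) = ?p (g j)"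
        using p_hom[OF x(1) g(1)[OF i]] by auto
      note c = x(1) g(1)[OF i] g(1)[OF j(1)]
      have "i \<noteq> j"
      proof
        assume "i = j"
        then have "?p x = \<one>\<^bsub>G Mod E\<^esub>"
          using j p_hom[OF c(1,2)] p_car c by (metis Q.r_cancel_one')
        then show False using p_one x by simp
      qed
      let ?e = "inv (g j) \<otimes> (x \<otimes> g i)"
      have "?p ?e = \<one>\<^bsub>G Mod E\<^esub>"
        using j(2) p_hom[of "inv (g j)" "x \<otimes> g i"] p_hom[of "inv (g j)" "g j"] c
          p_one[of \<one>] N.one_closed by simp
      then have e: "?e \<in> E" using p_one c by simp
      have "\<exists>!h. h \<in> H i \<and> ?e \<otimes> h \<in> H j"
        by (rule complementary_subgroups_unique_solution[OF sE finE])
          (use H disj[of j i] i j \<open>i \<noteq> j\<close> e cE in \<open>auto simp: power2_eq_square\<close>)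
      then obtain h where h: "h \<in> H i" "?e \<otimes> h \<in> H j"
        and uh: "\<And>h'. h' \<in> H i \<Longrightarrow> ?e \<otimes> h' \<in> H j \<Longrightarrow> h' = h" by blast
      have shift: "x \<otimes> (g i \<otimes> h') = g j \<otimes> (?e \<otimes> h')" if "h' \<in> H i" for h'
      proof -
        have "g j \<otimes> ?e = x \<otimes> g i" using c by (simp flip: m_assoc)
        then show ?thesis using c Hc[OF i that] by (simp flip: m_assoc)
      qed
      have "{d \<in> g i <# H i. x \<otimes> d \<in> D} = {g i \<otimes> h}"
      proof (intro equalityI subsetI)
        fix d assume "d \<in> {d \<in> g i <# H i. x \<otimes> d \<in> D}"
        then obtain h' k where h': "h' \<in> H i" "d = g i \<otimes> h'" "d \<in> g i <# H i"
          and k: "k \<in> I" "x \<otimes> d \<in> g k <# H k" by (auto simp: l_coset_def D_iff)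
        have "?p (g k) = ?p (g j)"
          using p_D[OF k] p_D[OF i h'(3)] p_hom[OF x(1)] j(2) c by metis
        then have "k = j" using g(2) k(1) j(1) by (auto dest: inj_onD)
        with k obtain h2 where h2: "h2 \<in> H j" "x \<otimes> d = g j \<otimes> h2" by (auto simp: l_coset_def)
        then have "?e \<otimes> h' = h2"
          using shift[OF h'(1)] h'(2) c Hc[OF i h'(1)] Hc[OF j(1) h2(1)] by simp
        then show "d \<in> {g i \<otimes> h}" using uh h' h2 by simp
      next
        fix d assume "d \<in> {g i \<otimes> h}"
        then show "d \<in> {d \<in> g i <# H i. x \<otimes> d \<in> D}"
          using h shift[OF h(1)] j(1) by (auto simp: l_coset_def D_iff)
      qed
      then show ?thesis using True by simp
    qed
    then have "card {d \<in> D. x \<otimes> d \<in> D} = card {i \<in> I. ?P i}"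
      using card_part[of "\<lambda>d. x \<otimes> d \<in> D"] I(1) by (simp add: sum.If_cases Int_def)
    also have "\<dots> = card ((\<lambda>i. ?p (g i)) ` {i \<in> I. ?P i})"
      using g(2) by (intro card_image[symmetric]) (auto intro: inj_on_subset)
    also have "(\<lambda>i. ?p (g i)) ` {i \<in> I. ?P i} = {c \<in> ?U. ?p x \<otimes>\<^bsub>G Mod E\<^esub> c \<in> ?U}" by (rule Compr_image_eq[symmetric])
    also have "card \<dots> = order (G Mod E) - 2"
    proof (rule Q.card_translate_complement_point[OF finQ])
      show "?U \<subseteq> carrier (G Mod E)" using p_car g(1) by blast
      show "Suc (card ?U) = order (G Mod E)" using card_image[OF g(2)] I cardQ by simp
    qed (use p_car p_one x in auto)
    finally show ?thesis using cardQ by simp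
  qed
  have Dc: "D \<subseteq> carrier G" using p_D(2) by (auto simp: D_iff)
  have "card {(d1, d2). d1 \<in> D \<and> d2 \<in> D \<and> d1 \<otimes> inv d2 = x} = q"
    if x: "x \<in> carrier G - {\<one>}" for x
  proof -
    have "{(d1, d2). d1 \<in> D \<and> d2 \<in> D \<and> d1 \<otimes> inv d2 = x}
        = (\<lambda>d. (x \<otimes> d, d)) ` {d \<in> D. x \<otimes> d \<in> D}"
    proof (intro equalityI subsetI)
      fix z assume "z \<in> {(d1, d2). d1 \<in> D \<and> d2 \<in> D \<and> d1 \<otimes> inv d2 = x}"
      then obtain d1 d2 where z: "z = (d1, d2)" "d1 \<in> D" "d2 \<in> D" "d1 \<otimes> inv d2 = x" by blast
      moreover have "d1 \<in> carrier G" "d2 \<in> carrier G" using z Dc by auto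
      ultimately have "d1 = x \<otimes> d2" by (auto simp: m_assoc)
      then show "z \<in> (\<lambda>d. (x \<otimes> d, d)) ` {d \<in> D. x \<otimes> d \<in> D}" using z by blast
    next
      fix z assume "z \<in> (\<lambda>d. (x \<otimes> d, d)) ` {d \<in> D. x \<otimes> d \<in> D}"
      then obtain d where z: "z = (x \<otimes> d, d)" "d \<in> D" "x \<otimes> d \<in> D" by blast
      then have "x \<otimes> d \<otimes> inv d = x" using x Dc by (simp add: m_assoc subset_eq)
      then show "z \<in> {(d1, d2). d1 \<in> D \<and> d2 \<in> D \<and> d1 \<otimes> inv d2 = x}" using z by blast
    qed
    then have "card {(d1, d2). d1 \<in> D \<and> d2 \<in> D \<and> d1 \<otimes> inv d2 = x}
        = card {d \<in> D. x \<otimes> d \<in> D}"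
      by (simp add: card_image inj_on_def)
    then show ?thesis using inE notinE x by (cases "x \<in> E") auto
  qed
  then show ?thesis
    unfolding difference_set_def D_def[symmetric] using is_group fin Dc cG cardD by (auto simp: order_def)
qed

section \<open>Lines of the plane and the exchange of coordinates\<close>

text \<open>
  Two points can always be added to an invariant set that misses at least two: a 2-cycle of \<open>f\<close>, or
  two fixed points if all the points outside are fixed. This gives every even size; the fixed point
  \<open>p\<close>, held back at first, corrects the parity.
\<close>

lemma involution_invariant_subset:
  assumes X: "finite X" and f: "\<And>x. x \<in> X \<Longrightarrow> f x \<in> X" "\<And>x. x \<in> X \<Longrightarrow> f (f x) = x"
    and p: "p \<in> X" "f p = p" and n: "n \<le> card X"
  shows "\<exists>S\<subseteq>X. card S = n \<and> (\<forall>x\<in>S. f x \<in> S)"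
proof -
  have even_case: "2 * k \<le> card X \<Longrightarrow> \<exists>S\<subseteq>X. card S = 2 * k \<and> (\<forall>x\<in>S. f x \<in> S)"
    if "finite X" "\<And>x. x \<in> X \<Longrightarrow> f x \<in> X" "\<And>x. x \<in> X \<Longrightarrow> f (f x) = x" for k X
  proof (induction k)
    case 0
    show ?case by (intro exI[of _ "{}"]) auto
  next
    case (Suc k)
    then obtain S where S: "S \<subseteq> X" "card S = 2 * k" "\<And>x. x \<in> S \<Longrightarrow> f x \<in> S" by auto
    have finS: "finite S" using S(1) that(1) by (rule finite_subset)
    have notS: "f x \<notin> S" if "x \<in> X - S" for x
      using S(3)[of "f x"] \<open>\<And>x. x \<in> X \<Longrightarrow> f (f x) = x\<close>[of x] that by auto
    have big: "2 \<le> card (X - S)"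
      using card_Diff_subset[OF finS S(1)] S(2) Suc.prems by simp
    have "\<exists>a b. a \<in> X - S \<and> b \<in> X - S \<and> a \<noteq> b \<and> f a \<in> {a, b} \<and> f b \<in> {a, b}"
    proof (cases "\<exists>a\<in>X - S. f a \<noteq> a")
      case True
      then obtain a where "a \<in> X - S" "f a \<noteq> a" by blast
      then show ?thesis using that(2,3) notS by (intro exI[of _ a] exI[of _ "f a"]) auto
    next
      case False
      obtain a b where "a \<in> X - S" "b \<in> X - S" "a \<noteq> b"
        using big by (meson card_2_iff' obtain_subset_with_card_n subsetD)
      then show ?thesis using False by blast
    qed
    then obtain a b where ab: "a \<in> X - S" "b \<in> X - S" "a \<noteq> b" "f a \<in> {a, b}" "f b \<in> {a, b}"
      by blast
    then show ?case
      using S finS by (intro exI[of _ "insert a (insert b S)"]) auto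
  qed
  show ?thesis
  proof (cases "even n")
    case True
    then show ?thesis using even_case[OF X f, of "n div 2"] n by auto
  next
    case False
    then obtain k where k: "n = Suc (2 * k)" by (auto elim: oddE)
    have "f x \<in> X - {p}" if "x \<in> X - {p}" for x using f p that by (metis Diff_iff singletonD singletonI)
    moreover have "2 * k \<le> card (X - {p})" using X p n k by simp
    ultimately have "\<exists>S\<subseteq>X - {p}. card S = 2 * k \<and> (\<forall>x\<in>S. f x \<in> S)"
      using X f(2) by (intro even_case) auto
    then obtain S where S: "S \<subseteq> X - {p}" "card S = 2 * k" "\<And>x. x \<in> S \<Longrightarrow> f x \<in> S"
      by blast
    then have "finite S" "p \<notin> S" using X by (auto intro: finite_subset)
    then show ?thesis using S p k by (intro exI[of _ "insert p S"]) auto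
  qed
qed

text \<open>
  The lines through the origin of the plane over a field are indexed by their slopes, with None for
  the infinite slope.
\<close>

primrec line :: "'a::field option \<Rightarrow> ('a \<times> 'a) set" where
  "line None = {v. fst v = 0}"
| "line (Some s) = {v. snd v = s * fst v}"

primrec swap_slope :: "'a::field option \<Rightarrow> 'a option" where
  "swap_slope None = Some 0"
| "swap_slope (Some s) = (if s = 0 then None else Some (inverse s))"

lemma swap_slope_swap_slope [simp]: "swap_slope (swap_slope p) = p"
  by (cases p) auto

lemma swap_in_line_iff: "prod.swap v \<in> line p \<longleftrightarrow> v \<in> line (swap_slope p)"
  by (cases p; cases v) (auto simp: field_simps)

lemma zero_in_line: "0 \<in> line p"
  by (cases p) auto

lemma add_in_line: "v \<in> line p \<Longrightarrow> w \<in> line p \<Longrightarrow> v + w \<in> line p"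
  by (cases p) (auto simp: algebra_simps)

lemma uminus_in_line: "v \<in> line p \<Longrightarrow> - v \<in> line p"
  by (cases p) auto

lemma ex1_line:
  assumes "v \<noteq> 0"
  shows "\<exists>!p. v \<in> line p"
proof (cases "fst v = 0")
  case True
  then have "snd v \<noteq> 0" using assms by (simp add: prod_eq_iff)
  then have "v \<in> line p \<longleftrightarrow> p = None" for p using True by (cases p) auto
  then show ?thesis by simp
next
  case False
  then have "v \<in> line p \<longleftrightarrow> p = Some (snd v / fst v)" for p by (cases p) (auto simp: field_simps)
  then show ?thesis by simp
qed

lemma card_line: "card (line p :: ('a::field \<times> 'a) set) = CARD('a)"
proof (cases p)
  case None
  then have "line p = Pair 0 ` (UNIV :: 'a set)" by auto
  then show ?thesis by (simp add: card_image inj_on_def)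
next
  case (Some s)
  then have "line p = (\<lambda>t. (t, s * t)) ` UNIV" by auto
  then show ?thesis by (simp add: card_image inj_on_def)
qed

section \<open>Elements of the semidirect product\<close>

text \<open>
  The automorphism group \<open>\<langle>\<phi>\<rangle>\<close> has order 2, so its elements are coded by truth values, with False
  for the identity; composition becomes \<open>\<noteq>\<close>. All later computations take place in
  these coordinates.
\<close>

definition elt :: "nat \<Rightarrow> bool \<Rightarrow> 'a::field \<times> 'a \<Rightarrow> int
    \<Rightarrow> (('a \<times> 'a) \<times> int \<Rightarrow> ('a \<times> 'a) \<times> int) \<times> ('a \<times> 'a) \<times> int" where
  "elt q s b c = (if s then phi q else \<one>\<^bsub>AutoGroup (grp_G q)\<^esub>, b, c)"

text \<open>The modulus \<open>q + 2\<close> is kept in one syntactic form, so that facts about \<open>K\<close> keep matching.\<close>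

declare add_2_eq_Suc [simp del] add_2_eq_Suc' [simp del]

lemma grp_E_simps [simp]:
  "carrier grp_E = UNIV" "mult grp_E = (+)" "one grp_E = 0"
  by (simp_all add: grp_E_def)

lemma carrier_grp_K: "carrier (grp_K q) = {0..<int q + 2}"
  by (simp add: carrier_integer_mod_group add.commute)

lemma phi_neq_one: "phi q \<noteq> (\<one>\<^bsub>AutoGroup (grp_G q)\<^esub> :: (('a::field \<times> 'a) \<times> int \<Rightarrow> _))"
proof -
  interpret Au: group "AutoGroup (grp_G q :: (('a \<times> 'a) \<times> int) monoid)"
    by (rule group.AutoGroup[OF group_grp_G])
  show ?thesis using phi_ord[of q, where 'a = 'a] Au.ord_id by auto
qed

lemma phi_phi:
  "phi q \<otimes>\<^bsub>AutoGroup (grp_G q)\<^esub> phi q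
    = (\<one>\<^bsub>AutoGroup (grp_G q)\<^esub> :: (('a::field \<times> 'a) \<times> int \<Rightarrow> _))"
proof -
  interpret Au: group "AutoGroup (grp_G q :: (('a \<times> 'a) \<times> int) monoid)"
    by (rule group.AutoGroup[OF group_grp_G])
  have c: "(phi q :: (('a \<times> 'a) \<times> int \<Rightarrow> _)) \<in> carrier (AutoGroup (grp_G q))"
    using phi_in_auto by (auto simp: AutoGroup_def)
  have "phi q [^]\<^bsub>AutoGroup (grp_G q :: (('a \<times> 'a) \<times> int) monoid)\<^esub> (2::nat)
      = \<one>\<^bsub>AutoGroup (grp_G q)\<^esub>"
    using Au.pow_ord_eq_1[OF c] phi_ord[of q, where 'a = 'a] by simp
  then show ?thesis
    using c by (metis Au.nat_pow_Suc Au.nat_pow_0 Au.l_one numeral_2_eq_2)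
qed

lemma generate_phi:
  "generate (AutoGroup (grp_G q :: (('a::field \<times> 'a) \<times> int) monoid)) {phi q}
    = {\<one>\<^bsub>AutoGroup (grp_G q)\<^esub>, phi q}"
proof -
  let ?A = "AutoGroup (grp_G q :: (('a \<times> 'a) \<times> int) monoid)"
  interpret Au: group ?A by (rule group.AutoGroup[OF group_grp_G])
  have c: "phi q \<in> carrier ?A"
    using phi_in_auto by (auto simp: AutoGroup_def)
  have "inv\<^bsub>?A\<^esub> phi q = phi q" using Au.inv_equality[OF phi_phi c c] .
  then have "subgroup {\<one>\<^bsub>?A\<^esub>, phi q} ?A"
    using c phi_phi by (intro Au.subgroupI) auto
  then have "generate ?A {phi q} \<subseteq> {\<one>\<^bsub>?A\<^esub>, phi q}"
    by (intro Au.generate_subgroup_incl) auto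
  then show ?thesis by (auto intro: generate.one generate.incl)
qed

lemma elt_eq_iff [simp]: "elt q s b c = elt q t b' c' \<longleftrightarrow> s = t \<and> b = b' \<and> c = c'"
  using phi_neq_one[of q, where 'a = 'a] phi_neq_one[of q, where 'a = 'a, symmetric]
  by (cases s; cases t) (simp_all add: elt_def)

lemma carrier_phi_G: "carrier (phi_G q) = {elt q s b c | s b c. c \<in> carrier (grp_K q)}"
proof -
  have "x \<in> carrier (phi_G q) \<longleftrightarrow> (\<exists>s b c. x = elt q s b c \<and> c \<in> carrier (grp_K q))" for x
    by (cases x) (simp add: phi_G_def semidirect_def generate_phi elt_def ex_bool_eq disj_commute)
  then show ?thesis by blast
qed

lemma elt_in_carrier [simp]: "elt q s b c \<in> carrier (phi_G q) \<longleftrightarrow> c \<in> carrier (grp_K q)"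
  by (auto simp: carrier_phi_G)

lemma one_phi_G: "\<one>\<^bsub>phi_G q\<^esub> = elt q False 0 0"
  by (simp add: phi_G_def semidirect_def elt_def zero_prod_def)

lemma elt_mult:
  fixes b b' :: "'a::field \<times> 'a"
  assumes c: "c \<in> carrier (grp_K q)"
  shows "elt q s b c \<otimes>\<^bsub>phi_G q\<^esub> elt q t b' c'
    = elt q (s \<noteq> t) ((if t then prod.swap b else b) + b')
        (((if t then - c else c) + c') mod (int q + 2))"
proof -
  let ?A = "AutoGroup (grp_G q :: (('a \<times> 'a) \<times> int) monoid)"
  interpret Au: group ?A by (rule group.AutoGroup[OF group_grp_G])
  have p: "phi q \<in> carrier ?A"
    using phi_in_auto by (auto simp: AutoGroup_def)
  have bc: "(b, c) \<in> carrier (grp_G q)" using c by simp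
  have "(if t then phi q else \<one>\<^bsub>?A\<^esub>) (b, c)
      = (if t then (prod.swap b, (- c) mod (int q + 2)) else (b, c))"
    using bc phi_apply[OF c, of "fst b" "snd b"] by (simp add: AutoGroup_def BijGroup_def prod.swap_def)
  moreover have "(if t then phi q else \<one>\<^bsub>?A\<^esub>) \<otimes>\<^bsub>?A\<^esub> (if s then phi q else \<one>\<^bsub>?A\<^esub>)
      = (if s \<noteq> t then phi q else \<one>\<^bsub>?A\<^esub>)"
    using p phi_phi by auto
  ultimately show ?thesis
    by (simp add: elt_def phi_G_def semidirect_def add.commute mod_add_right_eq)
qed

lemma elt_inv:
  assumes c: "c \<in> carrier (grp_K q)"
  shows "inv\<^bsub>phi_G q\<^esub> elt q s b c
    = elt q s (if s then - prod.swap b else - b) (if s then c else (- c) mod (int q + 2))"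
proof -
  interpret P: group "phi_G q :: ((('a \<times> 'a) \<times> int \<Rightarrow> _) \<times> _) monoid" by (rule group_phi_G)
  show ?thesis
  proof (rule P.inv_equality)
    show "elt q s (if s then - prod.swap b else - b) (if s then c else (- c) mod (int q + 2))
        \<otimes>\<^bsub>phi_G q\<^esub> elt q s b c = \<one>\<^bsub>phi_G q\<^esub>"
      using c by (cases b) (auto simp: elt_mult one_phi_G carrier_grp_K zero_prod_def mod_add_left_eq)
  qed (use c in \<open>auto simp: carrier_grp_K\<close>)
qed

section \<open>The elements of the generated subgroup\<close>

text \<open>
  The components in \<open>K\<close> of those members of the generated subgroup whose automorphism part is coded
  by \<open>s\<close>: the subgroup \<open>\<langle>y\<rangle>\<close> for the identity and its coset \<open>u + \<langle>y\<rangle>\<close> for \<open>\<phi>\<close>. As these two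
  kinds are distinguished by \<open>s\<close> and not by their \<open>K\<close>-component, the case \<open>q = 2\<close>, where
  \<open>u \<in> \<langle>y\<rangle>\<close>, needs no separate treatment.
\<close>

definition K_part :: "nat \<Rightarrow> int \<Rightarrow> int \<Rightarrow> bool \<Rightarrow> int set" where
  "K_part q u y s = {c \<in> carrier (grp_K q).
     (c - (if s then u else 0)) mod (int q + 2) \<in> generate (grp_K q) {y}}"

text \<open>
  The integers whose residue lies in \<open>\<langle>y\<rangle>\<close> form a subgroup of the integers, which removes the
  reductions modulo \<open>q + 2\<close> from closure arguments.
\<close>

lemma generate_grp_K_mod:
  assumes y: "y \<in> carrier (grp_K q)"
  defines "Z \<equiv> {c. c mod (int q + 2) \<in> generate (grp_K q) {y}}"
  shows "c \<in> Z \<Longrightarrow> c' \<in> Z \<Longrightarrow> c + c' \<in> Z" "c \<in> Z \<Longrightarrow> - c \<in> Z" "0 \<in> Z"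
proof -
  interpret K: group "grp_K q" by simp
  have Y: "subgroup (generate (grp_K q) {y}) (grp_K q)"
    using y by (intro K.generate_is_subgroup) auto
  show "c + c' \<in> Z" if "c \<in> Z" "c' \<in> Z"
    using subgroup.m_closed[OF Y, of "c mod (int q + 2)" "c' mod (int q + 2)"] that
    by (simp add: Z_def mod_add_eq add.commute)
  show "- c \<in> Z" if "c \<in> Z"
    using subgroup.m_inv_closed[OF Y, of "c mod (int q + 2)"] that
    by (simp add: Z_def carrier_grp_K mod_minus_eq add.commute)
  show "0 \<in> Z"
    using subgroup.one_closed[OF Y] by (simp add: Z_def)
qed

lemma K_part_mult:
  assumes y: "y \<in> carrier (grp_K q)"
    and c: "c \<in> K_part q u y s" "c' \<in> K_part q u y t"
  shows "((if t then - c else c) + c') mod (int q + 2) \<in> K_part q u y (s \<noteq> t)"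
proof -
  note Z = generate_grp_K_mod[OF y]
  let ?Z = "{c. c mod (int q + 2) \<in> generate (grp_K q) {y}}"
  have cc: "c - (if s then u else 0) \<in> ?Z" "c' - (if t then u else 0) \<in> ?Z"
    using c by (auto simp: K_part_def)
  have "(if t then - c else c) + c' - (if s \<noteq> t then u else 0) \<in> ?Z"
    using Z(1)[OF cc] Z(1)[OF Z(2)[OF cc(1)] cc(2)] by (cases s; cases t) (simp_all add: algebra_simps)
  then show ?thesis
    by (simp add: K_part_def carrier_grp_K mod_diff_left_eq)
qed

lemma card_K_part:
  assumes u: "u \<in> carrier (grp_K q)" and y: "y \<in> carrier (grp_K q)"
  shows "card (K_part q u y s) = group.ord (grp_K q) y"
proof -
  interpret K: group "grp_K q" by simp
  let ?v = "if s then u else 0"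
  let ?Y = "generate (grp_K q) {y}"
  have Y: "?Y \<subseteq> {0..<int q + 2}"
    using K.generate_incl[of "{y}"] y by (simp add: carrier_grp_K)
  have "bij_betw (\<lambda>c. (c - ?v) mod (int q + 2)) (K_part q u y s) ?Y"
    by (rule bij_betw_byWitness[where f' = "\<lambda>c. (c + ?v) mod (int q + 2)"])
      (use Y in \<open>auto simp: K_part_def carrier_grp_K mod_diff_left_eq mod_add_left_eq\<close>)
  then show ?thesis
    using bij_betw_same_card K.generate_pow_card[OF y] by metis
qed

text \<open>
  The right-hand side is closed under products and inverses because \<open>\<phi>\<close> negates \<open>K\<close>: in
  \<open>(\<phi>, b, u + c) (\<phi>, b', u + c')\<close> the two summands \<open>u\<close> cancel. Conversely, an element
  with automorphism part \<open>\<phi>\<close> is the generator \<open>(\<phi>, 0, u)\<close> times one of \<open>E \<times> \<langle>y\<rangle>\<close>.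
\<close>

lemma carrier_calG:
  fixes B :: "('a::field \<times> 'a) set"
  assumes B: "generate grp_E B = carrier grp_E"
    and u: "u \<in> carrier (grp_K q)" and y: "y \<in> carrier (grp_K q)"
  shows "carrier (calG q B u y) = {elt q s b c | s b c. c \<in> K_part q u y s}" (is "_ = ?C")
proof -
  let ?P = "phi_G q :: ((('a \<times> 'a) \<times> int \<Rightarrow> _) \<times> _) monoid"
  interpret P: group ?P by (rule group_phi_G)
  interpret K: group "grp_K q" by simp
  interpret E: group "grp_E :: ('a \<times> 'a) monoid" by (rule group_grp_E)
  let ?X = "{elt q True 0 u, elt q False 0 y} \<union> (\<lambda>b. elt q False b 0) ` B"
  have X: "?X \<subseteq> carrier ?P" using u y by auto
  have "{(phi q, 0, u), (\<one>\<^bsub>AutoGroup (grp_G q)\<^esub>, 0, y)} \<union>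
      {(\<one>\<^bsub>AutoGroup (grp_G q)\<^esub>, b, 0) | b. b \<in> B} = ?X"
    by (auto simp: elt_def)
  then have car: "carrier (calG q B u y) = generate ?P ?X"
    using X by (simp add: calG_def carrier_subgroup_generated Int_absorb1)
  have sub: "c \<in> carrier (grp_K q)" if "c \<in> K_part q u y s" for c s
    using that by (simp add: K_part_def)
  have "subgroup ?C ?P"
  proof (rule P.subgroupI)
    show "?C \<subseteq> carrier ?P" using sub by auto
    have "0 \<in> K_part q u y False"
      using generate_grp_K_mod(3)[OF y] by (simp add: K_part_def)
    then show "?C \<noteq> {}" by blast
    fix a assume "a \<in> ?C"
    then obtain s b c where a: "a = elt q s b c" "c \<in> K_part q u y s" by blast
    have "(if s then c else (- c) mod (int q + 2)) \<in> K_part q u y s"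
      using a(2) generate_grp_K_mod(2)[OF y, of c]
      by (auto simp: K_part_def carrier_grp_K)
    then show "inv\<^bsub>?P\<^esub> a \<in> ?C"
      unfolding a(1) elt_inv[OF sub[OF a(2)]] by blast
    fix a' assume "a' \<in> ?C"
    then obtain t b' c' where a': "a' = elt q t b' c'" "c' \<in> K_part q u y t" by blast
    show "a \<otimes>\<^bsub>?P\<^esub> a' \<in> ?C"
      unfolding a(1) a'(1) elt_mult[OF sub[OF a(2)]] using K_part_mult[OF y a(2) a'(2)] by blast
  qed
  moreover have "?X \<subseteq> ?C"
  proof -
    have "u \<in> K_part q u y True" "y \<in> K_part q u y False" "0 \<in> K_part q u y False"
      using u y generate_grp_K_mod(3)[OF y] generate.incl[of y "{y}" "grp_K q"]
      by (auto simp: K_part_def carrier_grp_K)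
    then show ?thesis by blast
  qed
  ultimately have "generate ?P ?X \<subseteq> ?C" by (intro P.generate_subgroup_incl)
  moreover have "?C \<subseteq> generate ?P ?X"
  proof
    have "group_hom grp_E ?P (\<lambda>b. elt q False b 0)"
      by unfold_locales (auto intro!: homI simp: elt_mult)
    then have "(\<lambda>b. elt q False b 0) ` generate grp_E B = generate ?P ((\<lambda>b. elt q False b 0) ` B)"
      by (rule group_hom.generate_img[symmetric]) simp
    then have inE: "elt q False b 0 \<in> generate ?P ?X" for b
      using P.mono_generate[of "(\<lambda>b. elt q False b 0) ` B" ?X] B by auto
    have "group_hom (grp_K q) ?P (\<lambda>c. elt q False 0 c)"
      by unfold_locales (auto intro!: homI simp: elt_mult add.commute)
    then have "(\<lambda>c. elt q False 0 c) ` generate (grp_K q) {y}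
        = generate ?P ((\<lambda>c. elt q False 0 c) ` {y})"
      using y by (intro group_hom.generate_img[symmetric]) auto
    then have inY: "elt q False 0 c \<in> generate ?P ?X" if "c \<in> generate (grp_K q) {y}" for c
      using P.mono_generate[of "{elt q False 0 y}" ?X] that by auto
    fix a assume "a \<in> ?C"
    then obtain s b c where a: "a = elt q s b c" "c \<in> K_part q u y s" by blast
    let ?c = "(c - (if s then u else 0)) mod (int q + 2)"
    have "elt q False b 0 \<otimes>\<^bsub>?P\<^esub> elt q False 0 ?c \<in> generate ?P ?X"
      using a(2) by (intro generate.eng inE inY) (simp add: K_part_def)
    then have F: "elt q False b ?c \<in> generate ?P ?X" by (simp add: elt_mult)
    show "a \<in> generate ?P ?X"
    proof (cases s)
      case True
      have "elt q True 0 u \<otimes>\<^bsub>?P\<^esub> elt q False b ?c \<in> generate ?P ?X"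
        by (intro generate.eng F generate.incl) simp
      moreover have "(u + ?c) mod (int q + 2) = c"
        using True a(2) by (simp add: K_part_def carrier_grp_K mod_add_right_eq)
      ultimately show ?thesis using True u a(1) by (simp add: elt_mult)
    next
      case False
      then show ?thesis using F a by (simp add: K_part_def carrier_grp_K)
    qed
  qed
  ultimately show ?thesis using car by blast
qed

section \<open>The twisted partitions in the group\<close>

lemma inv_grp_E [simp]: "inv\<^bsub>grp_E\<^esub> v = - v"
  by (rule group.inv_equality[OF group_grp_E]) auto

lemma subgroup_line: "subgroup (line p) grp_E"
proof (rule group.subgroupI[OF group_grp_E])
  show "line p \<noteq> {}" using zero_in_line by blast
qed (simp_all add: add_in_line uminus_in_line)

lemma calG_simps [simp]:
  "x \<otimes>\<^bsub>calG q B u y\<^esub> z = x \<otimes>\<^bsub>phi_G q\<^esub> z" "\<one>\<^bsub>calG q B u y\<^esub> = elt q False 0 0"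
  by (simp_all add: calG_def one_phi_G)

lemma group_calG: "group (calG q B u y)"
  unfolding calG_def by (rule group.group_subgroup_generated[OF group_phi_G])

lemma K_part_subset: "K_part q u y s \<subseteq> {0..<int q + 2}"
  by (auto simp: K_part_def carrier_grp_K)

lemma calG_not_comm:
  fixes B :: "('a::field \<times> 'a) set"
  assumes B: "generate grp_E B = carrier grp_E"
    and u: "u \<in> carrier (grp_K q)" and y: "y \<in> carrier (grp_K q)"
  shows "\<not> comm_group (calG q B u y)"
proof
  let ?M = "calG q B u y"
  assume "comm_group ?M"
  then interpret M: comm_group ?M .
  have "u \<in> K_part q u y True" "0 \<in> K_part q u y False"
    using u generate_grp_K_mod(3)[OF y] by (auto simp: K_part_def)
  then have "elt q True 0 u \<in> carrier ?M" "elt q False (1, 0) 0 \<in> carrier ?M"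
    unfolding carrier_calG[OF B u y] by blast+
  then have "elt q True 0 u \<otimes>\<^bsub>?M\<^esub> elt q False (1, 0) 0 = elt q False (1, 0) 0 \<otimes>\<^bsub>?M\<^esub> elt q True 0 u"
    by (rule M.m_comm)
  then show False using u by (simp add: elt_mult)
qed

text \<open>
  The lines of \<open>E\<close> index the pieces of the difference set. A coset of \<open>E\<close> is given by the
  automorphism part \<open>s\<close> and the component in \<open>K\<close>; conjugation by its elements fixes every line if
  \<open>s\<close> is False and exchanges the coordinates if \<open>s\<close> is True. So if the cosets with \<open>s\<close> True are
  assigned exactly to the lines of a set \<open>S\<close> closed under \<^const>\<open>swap_slope\<close>, then conjugation
  permutes the lines. Writing \<open>q = 2 * k\<close>, each of the two kinds has \<open>k + 1\<close> cosets, and the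
  \<open>2 * k + 1\<close> lines fit into them when \<open>S\<close> has \<open>k + 1\<close> members; such an \<open>S\<close> exists because the
  diagonal, the line of slope 1, is fixed by the exchange.
\<close>

theorem difference_set_calG:
  fixes B :: "('a::{finite,field} \<times> 'a) set"
  assumes q: "even q" "CARD('a) = q"
    and B: "generate grp_E B = carrier grp_E"
    and u: "u \<in> carrier (grp_K q)"
    and y: "y \<in> carrier (grp_K q)" "group.ord (grp_K q) y = (q + 2) div 2"
  shows "\<exists>D. difference_set (calG q B u y) (q\<^sup>2 * (q + 2), q * (q + 1), q) D"
proof -
  let ?M = "calG q B u y"
  let ?W = "K_part q u y"
  interpret M: group ?M by (rule group_calG)
  obtain k where k: "q = 2 * k" using q(1) by auto
  have W: "card (?W s) = k + 1" "finite (?W s)" for s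
    using card_K_part[OF u y(1)] y(2) k finite_subset[OF K_part_subset] by auto
  have W_mod: "c \<in> carrier (grp_K q)" "c mod (int q + 2) = c" if "c \<in> ?W s" for c s
    using that by (auto simp: K_part_def carrier_grp_K)
  note car = carrier_calG[OF B u y(1)]
  have carrier_eq: "carrier ?M = (\<lambda>(s, b, c). elt q s b c) ` (SIGMA s:UNIV. UNIV \<times> ?W s)"
    unfolding car by (auto simp: image_iff Bex_def)
  have fin: "finite (carrier ?M)"
    unfolding carrier_eq using W(2) by (intro finite_imageI finite_SigmaI finite_cartesian_product) auto
  have "order ?M = card (SIGMA s:(UNIV :: bool set). (UNIV :: ('a \<times> 'a) set) \<times> ?W s)"
    unfolding order_def carrier_eq by (rule card_image) (auto simp: inj_on_def)
  also have "\<dots> = q\<^sup>2 * (q + 2)"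
    using W q by (simp add: card_SigmaI card_cartesian_product UNIV_bool card_prod power2_eq_square k algebra_simps)
  finally have order: "order ?M = q\<^sup>2 * (q + 2)" .

  let ?i = "\<lambda>b :: 'a \<times> 'a. elt q False b 0"
  let ?E = "range ?i"
  have "0 \<in> ?W False"
    using generate_grp_K_mod(3)[OF y(1)] by (simp add: K_part_def)
  then have "?i b \<in> carrier ?M" for b unfolding car by blast
  then have hom: "group_hom grp_E ?M ?i"
    by (intro group_hom.intro group_hom_axioms.intro group_grp_E group_calG homI)
      (auto simp: elt_mult)
  have sub_i: "subgroup (?i ` V) ?M" if "subgroup V grp_E" for V
    using that by (rule group_hom.subgroup_img_is_subgroup[OF hom])
  have sE: "subgroup ?E ?M"
    using sub_i[OF group.subgroup_self[OF group_grp_E]] by simp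
  have rc: "?E #>\<^bsub>?M\<^esub> elt q s b c = range (\<lambda>b. elt q s b c)" if c: "c \<in> ?W s" for s b c
  proof -
    have "?i b' \<otimes>\<^bsub>?M\<^esub> elt q s b c = elt q s ((if s then prod.swap b' else b') + b) c" for b'
      using W_mod(2)[OF c] by (simp add: elt_mult)
    then have "?E #>\<^bsub>?M\<^esub> elt q s b c = range (\<lambda>b'. elt q s ((if s then prod.swap b' else b') + b) c)"
      by (auto simp: r_coset_def)
    also have "\<dots> = (\<lambda>b. elt q s b c) ` range (\<lambda>b'. (if s then prod.swap b' else b') + b)"
      by (simp add: image_image)
    also have "surj (\<lambda>b'. (if s then prod.swap b' else b') + b)"
      by (rule surjI[where f = "\<lambda>b'. if s then prod.swap (b' - b) else b' - b"]) simp
    finally show ?thesis .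
  qed
  have lc: "elt q s b c <#\<^bsub>?M\<^esub> (?i ` V) = (\<lambda>v. elt q s (b + v) c) ` V" if c: "c \<in> ?W s" for s b c V
  proof -
    have "elt q s b c \<otimes>\<^bsub>?M\<^esub> ?i v = elt q s (b + v) c" for v
      using W_mod[OF c] by (simp add: elt_mult)
    then show ?thesis by (auto simp: l_coset_def)
  qed
  have N: "?E \<lhd> ?M"
  proof (rule M.normalI[OF sE], intro ballI)
    fix x assume "x \<in> carrier ?M"
    then obtain s b c where x: "x = elt q s b c" "c \<in> ?W s" unfolding car by blast
    have "range (\<lambda>v. elt q s (b + v) c) = (\<lambda>v. elt q s v c) ` range ((+) b)"
      by (simp only: image_image)
    then have "range (\<lambda>v. elt q s (b + v) c) = range (\<lambda>v. elt q s v c)"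
      by (simp only: surj_plus)
    then show "?E #>\<^bsub>?M\<^esub> x = x <#\<^bsub>?M\<^esub> ?E"
      unfolding x(1) rc[OF x(2)] lc[OF x(2)] by simp
  qed

  have "\<exists>S\<subseteq>(UNIV :: 'a option set). card S = k + 1 \<and> (\<forall>p\<in>S. swap_slope p \<in> S)"
    by (rule involution_invariant_subset[where p = "Some 1"]) (use q k in auto)
  then obtain S :: "'a option set" where S: "card S = k + 1" "\<And>p. p \<in> S \<Longrightarrow> swap_slope p \<in> S"
    by blast
  have "card (- S) = k" using S(1) q k by (simp add: Compl_eq_Diff_UNIV card_Diff_subset)
  then obtain f1 f2 where f1: "inj_on f1 S" "f1 ` S \<subseteq> ?W True"
    and f2: "inj_on f2 (- S)" "f2 ` (- S) \<subseteq> ?W False"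
    using W S(1) inj_on_iff_card_le[of S "?W True"] inj_on_iff_card_le[of "- S" "?W False"] by auto
  \<comment> \<open>The component in \<open>K\<close> of the coset assigned to the line \<open>p\<close>.\<close>
  define \<kappa> where "\<kappa> p = (if p \<in> S then f1 p else f2 p)" for p
  have \<kappa>W: "\<kappa> p \<in> ?W (p \<in> S)" for p using f1(2) f2(2) by (auto simp: \<kappa>_def)
  have \<kappa>inj: "p = r" if "(p \<in> S) = (r \<in> S)" "\<kappa> p = \<kappa> r" for p r
    using that inj_onD[OF f1(1), of p r] inj_onD[OF f2(1), of p r] by (auto simp: \<kappa>_def)
  let ?g = "\<lambda>p. elt q (p \<in> S) (0 :: 'a \<times> 'a) (\<kappa> p)"

  have "difference_set ?M (q\<^sup>2 * (q + 2), q * (q + 1), q) (\<Union>p\<in>UNIV. ?g p <#\<^bsub>?M\<^esub> ?i ` line p)"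
  proof (rule M.difference_set_of_twisted_partitions[OF fin N _ order])
    show "card ?E = q\<^sup>2"
      using q by (simp add: card_image inj_on_def power2_eq_square)
    show "card (UNIV :: 'a option set) = q + 1" using q by simp
    show "subgroup (?i ` line p) ?M" for p by (rule sub_i[OF subgroup_line])
    show "card (?i ` line p) = q" for p using q by (simp add: card_image inj_on_def card_line)
    show "?i ` line p \<inter> ?i ` line r = {\<one>\<^bsub>?M\<^esub>}" if "p \<noteq> r" for p r
    proof -
      have "line p \<inter> line r = {0}"
        using that zero_in_line ex1_line by blast
      moreover have "inj ?i" by (simp add: inj_on_def)
      ultimately show ?thesis by (simp flip: image_Int)
    qed
    show "?g p \<in> carrier ?M" for p unfolding car using \<kappa>W by blast
    show "inj (\<lambda>p. ?E #>\<^bsub>?M\<^esub> ?g p)"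
    proof (rule injI)
      fix p r assume "?E #>\<^bsub>?M\<^esub> ?g p = ?E #>\<^bsub>?M\<^esub> ?g r"
      then have "?g p \<in> range (\<lambda>b. elt q (r \<in> S) b (\<kappa> r))" unfolding rc[OF \<kappa>W] by blast
      then show "p = r" using \<kappa>inj by auto
    qed
    fix x assume "x \<in> ?E" "x \<noteq> \<one>\<^bsub>?M\<^esub>"
    then obtain v where v: "x = ?i v" "v \<noteq> 0" by auto
    have iff: "x \<otimes>\<^bsub>?M\<^esub> ?g p \<in> ?g p <#\<^bsub>?M\<^esub> ?i ` line p
        \<longleftrightarrow> v \<in> line (if p \<in> S then swap_slope p else p)" for p
      unfolding lc[OF \<kappa>W] v(1) using W_mod(2)[OF \<kappa>W]
      by (auto simp: elt_mult swap_in_line_iff image_iff)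
    obtain p0 where p0: "v \<in> line p0" "\<And>p. v \<in> line p \<Longrightarrow> p = p0"
      using ex1_line[OF v(2)] by blast
    \<comment> \<open>\<open>p0\<close> and its mirror image lie both in \<open>S\<close> or both outside it, so only one candidate is left.\<close>
    have "v \<in> line (if p \<in> S then swap_slope p else p)
        \<longleftrightarrow> p = (if p0 \<in> S then swap_slope p0 else p0)" for p
    proof -
      have "v \<in> line r \<longleftrightarrow> r = p0" for r using p0 by blast
      moreover have "swap_slope p \<in> S \<longleftrightarrow> p \<in> S" for p using S(2) swap_slope_swap_slope by metis
      moreover have "swap_slope p = p0 \<longleftrightarrow> p = swap_slope p0" by auto
      ultimately show ?thesis by auto
    qed
    then show "\<exists>!p. p \<in> UNIV \<and> x \<otimes>\<^bsub>?M\<^esub> ?g p \<in> ?g p <#\<^bsub>?M\<^esub> ?i ` line p"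
      unfolding iff by simp
  qed auto
  then show ?thesis by blast
qed

section \<open>The theorem\<close>

lemma mcfarland_parameters_1:
  assumes "q \<ge> 2"
  shows "mcfarland_parameters q 1 = (q\<^sup>2 * (q + 2), q * (q + 1), q)"
proof -
  obtain r where r: "q = Suc (Suc r)" using assms by (metis add_2_eq_Suc le_Suc_ex)
  have "q ^ 2 - 1 = (q + 1) * (q - 1)" by (simp add: r power2_eq_square algebra_simps)
  then have "(q ^ 2 - 1) div (q - 1) = q + 1"
    using r by (simp only: nonzero_mult_div_cancel_right)
  moreover have "(q - 1) div (q - 1) = 1" using assms by simp
  ultimately show ?thesis
    unfolding mcfarland_parameters_def one_add_one power_one_right by (simp add: algebra_simps)
qed

theorem theorem7p5:
  fixes d q :: nat
    and e :: "nat \<Rightarrow> 'a::{finite,field} \<times> 'a"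
    and u y :: int
  assumes "d \<ge> 1" and "q = 2 ^ d"
    and "CARD('a) = q"
    and "generate grp_E (e ` {1..2 * d}) = carrier grp_E"
    and "u \<in> carrier (grp_K q)" and "group.ord (grp_K q) u = 2"
    and "y \<in> carrier (grp_K q)" and "group.ord (grp_K q) y = (q + 2) div 2"
  shows "group (calG q (e ` {1..2 * d}) u y)
    \<and> \<not> comm_group (calG q (e ` {1..2 * d}) u y)
    \<and> mcfarland_parameters q 1 = (q\<^sup>2 * (q + 2), q * (q + 1), q)
    \<and> (\<exists>D. difference_set (calG q (e ` {1..2 * d}) u y) (mcfarland_parameters q 1) D)"
proof -
  have "even q" "q \<ge> 2" using assms(1,2) by (auto simp: self_le_power)
  then show ?thesis
    using group_calG calG_not_comm[OF assms(4,5,7)] mcfarland_parameters_1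
      difference_set_calG[OF _ assms(3,4,5,7,8)] by simp
qed

end
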